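(* For every formula $F$ of the language of intuitionistic epistemic logic: if $\mathsf{IEL}^-\vdash F$ then there is a normal realisation $r$ with $\mathsf{LPV}^-\vdash (tr(F))^r$; and if $\mathsf{IEL}\vdash F$ then there is a normal realisation $r$ with $\mathsf{LPV}\vdash (tr(F))^r$. (That is, every theorem of $\mathsf{IEL}^-$, resp. $\mathsf{IEL}$, is proof realisable.)
   Context: $\mathsf{IEL}^-$: in the language of intuitionistic propositional logic ($\bot,\land,\lor,\rightarrow$, with $\neg A:=A\rightarrow\bot$) plus a unary operator ${\bf K}$; axioms: axioms of intuitionistic propositional logic, ${\bf K}(A\rightarrow B)\rightarrow({\bf K}A\rightarrow{\bf K}B)$, $A\rightarrow{\bf K}A$; rule: Modus Ponens. $\mathsf{IEL}$ is $\mathsf{IEL}^-$ plus ${\bf K}A\rightarrow\neg\neg A$. Gödel translation $tr$ ("box every subformula") into the classical bimodal language with $\Box$ and ${\bf V}$: $tr(p)=\Box p$, $tr(\bot)=\Box\bot$, $tr(A\circ B)=\Box(tr(A)\circ tr(B))$ for $\circ\in\{\land,\lor,\rightarrow\}$, $tr(\neg A)=\Box\neg tr(A)$, $tr({\bf K}A)=\Box{\bf V}\,tr(A)$. $\mathsf{LPV}^-$: language of classical propositional logic extended by ${\bf V}A$ and $t{:}A$, with proof terms built from proof variables and proof constants by binary $\cdot$, $+$ and unary $!$. Axioms: classical propositional tautologies; $t{:}(A\rightarrow B)\rightarrow(s{:}A\rightarrow (t\cdot s){:}B)$; $t{:}A\rightarrow A$; $t{:}A\rightarrow\, !t{:}t{:}A$;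 $t{:}A\rightarrow (s+t){:}A$, $t{:}A\rightarrow (t+s){:}A$; ${\bf V}(A\rightarrow B)\rightarrow({\bf V}A\rightarrow {\bf V}B)$; $t{:}A\rightarrow {\bf V}A$. Rules: Modus Ponens and Axiom Necessitation (from an axiom $A$ infer $c{:}A$, $c$ a proof constant). $\mathsf{LPV}$ adds the axiom $\neg t{:}{\bf V}\bot$. A realisation $r$ of a formula $G$ in the language with $\Box,{\bf V}$ replaces each occurrence of $\Box$ by a proof term (so $\Box H$ becomes $t{:}H^r$). Polarity of occurrences of $\Box$: an occurrence in $F$ keeps its polarity in $G\rightarrow F$, $F\land G$, $G\land F$, $F\lor G$, $G\lor F$, $\Box F$ and reverses it in $F\rightarrow G$, $\neg F$; the outermost occurrence in a formula $\Box H$ is positive. A realisation is normal if every negative occurrence of $\Box$ is replaced by a proof variable. A formula $F$ of $\mathsf{IEL}^-$ (resp. $\mathsf{IEL}$) is proof realisable if $(tr(F))^r$ is valid in (a theorem of) $\mathsf{LPV}^-$ (resp. $\mathsf{LPV}$) for some normal realisation $r$. *)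

theory Defs
  imports Main
begin

section \<open>Intuitionistic epistemic logic\<close>

datatype iel_fm =
    IAtom nat
  | IBot                   (\<open>\<bottom>\<^sub>I\<close>)
  | IAnd iel_fm iel_fm     (infixr \<open>\<and>\<^sub>I\<close> 70)
  | IOr iel_fm iel_fm      (infixr \<open>\<or>\<^sub>I\<close> 65)
  | IImp iel_fm iel_fm     (infixr \<open>\<rightarrow>\<^sub>I\<close> 60)
  | IKnow iel_fm           (\<open>\<^bold>K _\<close> [80] 80)

abbreviation INeg :: "iel_fm \<Rightarrow> iel_fm" (\<open>\<not>\<^sub>I _\<close> [80] 80) where
  "\<not>\<^sub>I A \<equiv> A \<rightarrow>\<^sub>I \<bottom>\<^sub>I"

inductive iel_minus_axiom :: "iel_fm \<Rightarrow> bool" where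
  "iel_minus_axiom (A \<rightarrow>\<^sub>I B \<rightarrow>\<^sub>I A)"
| "iel_minus_axiom ((A \<rightarrow>\<^sub>I B \<rightarrow>\<^sub>I C) \<rightarrow>\<^sub>I (A \<rightarrow>\<^sub>I B) \<rightarrow>\<^sub>I A \<rightarrow>\<^sub>I C)"
| "iel_minus_axiom (A \<and>\<^sub>I B \<rightarrow>\<^sub>I A)"
| "iel_minus_axiom (A \<and>\<^sub>I B \<rightarrow>\<^sub>I B)"
| "iel_minus_axiom (A \<rightarrow>\<^sub>I B \<rightarrow>\<^sub>I A \<and>\<^sub>I B)"
| "iel_minus_axiom (A \<rightarrow>\<^sub>I A \<or>\<^sub>I B)"
| "iel_minus_axiom (B \<rightarrow>\<^sub>I A \<or>\<^sub>I B)"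
| "iel_minus_axiom ((A \<rightarrow>\<^sub>I C) \<rightarrow>\<^sub>I (B \<rightarrow>\<^sub>I C) \<rightarrow>\<^sub>I A \<or>\<^sub>I B \<rightarrow>\<^sub>I C)"
| "iel_minus_axiom (\<bottom>\<^sub>I \<rightarrow>\<^sub>I A)"
| "iel_minus_axiom (\<^bold>K (A \<rightarrow>\<^sub>I B) \<rightarrow>\<^sub>I \<^bold>K A \<rightarrow>\<^sub>I \<^bold>K B)"
| "iel_minus_axiom (A \<rightarrow>\<^sub>I \<^bold>K A)"

inductive iel_axiom :: "iel_fm \<Rightarrow> bool" where
  "iel_minus_axiom A \<Longrightarrow> iel_axiom A"
| "iel_axiom (\<^bold>K A \<rightarrow>\<^sub>I \<not>\<^sub>I \<not>\<^sub>I A)"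

inductive mp_derivable :: "(iel_fm \<Rightarrow> bool) \<Rightarrow> iel_fm \<Rightarrow> bool" for Ax where
  axiom: "Ax A \<Longrightarrow> mp_derivable Ax A"
| mp: "mp_derivable Ax (A \<rightarrow>\<^sub>I B) \<Longrightarrow> mp_derivable Ax A \<Longrightarrow> mp_derivable Ax B"

abbreviation iel_minus_theorem :: "iel_fm \<Rightarrow> bool" (\<open>IEL\<^sup>- \<turnstile> _\<close> [50] 50) where
  "IEL\<^sup>- \<turnstile> A \<equiv> mp_derivable iel_minus_axiom A"

abbreviation iel_theorem :: "iel_fm \<Rightarrow> bool" (\<open>IEL \<turnstile> _\<close> [50] 50) where
  "IEL \<turnstile> A \<equiv> mp_derivable iel_axiom A"


section \<open>The bimodal language and the Goedel translation\<close>

datatype bim_fm =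
    BAtom nat
  | BBot                   (\<open>\<bottom>\<^sub>B\<close>)
  | BAnd bim_fm bim_fm     (infixr \<open>\<and>\<^sub>B\<close> 70)
  | BOr bim_fm bim_fm      (infixr \<open>\<or>\<^sub>B\<close> 65)
  | BImp bim_fm bim_fm     (infixr \<open>\<rightarrow>\<^sub>B\<close> 60)
  | BBox bim_fm            (\<open>\<box> _\<close> [80] 80)
  | BVer bim_fm            (\<open>\<^bold>V\<^sub>B _\<close> [80] 80)

abbreviation BNeg :: "bim_fm \<Rightarrow> bim_fm" (\<open>\<not>\<^sub>B _\<close> [80] 80) where
  "\<not>\<^sub>B A \<equiv> A \<rightarrow>\<^sub>B \<bottom>\<^sub>B"

text \<open>
  The equations are tried in order: since negation abbreviates implication of falsum, the
  equation for negation has to precede the one for implication, which thus applies only to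
  implications whose consequent is not falsum.
\<close>

fun tr :: "iel_fm \<Rightarrow> bim_fm" where
  "tr (IAtom p) = \<box> (BAtom p)"
| "tr \<bottom>\<^sub>I = \<box> \<bottom>\<^sub>B"
| "tr (A \<and>\<^sub>I B) = \<box> (tr A \<and>\<^sub>B tr B)"
| "tr (A \<or>\<^sub>I B) = \<box> (tr A \<or>\<^sub>B tr B)"
| "tr (\<not>\<^sub>I A) = \<box> (\<not>\<^sub>B tr A)"
| "tr (A \<rightarrow>\<^sub>I B) = \<box> (tr A \<rightarrow>\<^sub>B tr B)"
| "tr (\<^bold>K A) = \<box> (\<^bold>V\<^sub>B (tr A))"


section \<open>The logics of proofs and verification\<close>

datatype proof_term =
    PVar nat
  | PConst nat
  | PApp proof_term proof_term  (infixl \<open>\<cdot>\<close> 90)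
  | PSum proof_term proof_term  (infixl \<open>\<^bold>+\<close> 85)
  | PCheck proof_term           (\<open>\<^bold>! _\<close> [95] 95)

datatype lpv_fm =
    Atom nat
  | Bot                         (\<open>\<^bold>\<bottom>\<close>)
  | And lpv_fm lpv_fm           (infixr \<open>\<^bold>\<and>\<close> 70)
  | Or lpv_fm lpv_fm            (infixr \<open>\<^bold>\<or>\<close> 65)
  | Imp lpv_fm lpv_fm           (infixr \<open>\<^bold>\<rightarrow>\<close> 60)
  | Ver lpv_fm                  (\<open>\<^bold>V _\<close> [80] 80)
  | Proves proof_term lpv_fm    (\<open>_ \<^bold>: _\<close> [81, 80] 80)

abbreviation Neg :: "lpv_fm \<Rightarrow> lpv_fm" (\<open>\<^bold>\<not> _\<close> [80] 80) where
  "\<^bold>\<not> A \<equiv> A \<^bold>\<rightarrow> \<^bold>\<bottom>"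

text \<open>
  Formulas of the form \<open>\<^bold>V A\<close> and \<open>t \<^bold>: A\<close> count as
  propositional atoms, each with a truth value of its own.
\<close>

fun truth :: "(lpv_fm \<Rightarrow> bool) \<Rightarrow> lpv_fm \<Rightarrow> bool" where
  "truth v (Atom p) \<longleftrightarrow> v (Atom p)"
| "truth v \<^bold>\<bottom> \<longleftrightarrow> False"
| "truth v (A \<^bold>\<and> B) \<longleftrightarrow> truth v A \<and> truth v B"
| "truth v (A \<^bold>\<or> B) \<longleftrightarrow> truth v A \<or> truth v B"
| "truth v (A \<^bold>\<rightarrow> B) \<longleftrightarrow> (truth v A \<longrightarrow> truth v B)"
| "truth v (\<^bold>V A) \<longleftrightarrow> v (\<^bold>V A)"
| "truth v (t \<^bold>: A) \<longleftrightarrow> v (t \<^bold>: A)"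

definition tautology :: "lpv_fm \<Rightarrow> bool" where
  "tautology A \<longleftrightarrow> (\<forall>v. truth v A)"

inductive lpv_minus_axiom :: "lpv_fm \<Rightarrow> bool" where
  "tautology A \<Longrightarrow> lpv_minus_axiom A"
| "lpv_minus_axiom (t \<^bold>: (A \<^bold>\<rightarrow> B) \<^bold>\<rightarrow> s \<^bold>: A \<^bold>\<rightarrow> (t \<cdot> s) \<^bold>: B)"
| "lpv_minus_axiom (t \<^bold>: A \<^bold>\<rightarrow> A)"
| "lpv_minus_axiom (t \<^bold>: A \<^bold>\<rightarrow> \<^bold>! t \<^bold>: t \<^bold>: A)"
| "lpv_minus_axiom (t \<^bold>: A \<^bold>\<rightarrow> (s \<^bold>+ t) \<^bold>: A)"
| "lpv_minus_axiom (t \<^bold>: A \<^bold>\<rightarrow> (t \<^bold>+ s) \<^bold>: A)"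
| "lpv_minus_axiom (\<^bold>V (A \<^bold>\<rightarrow> B) \<^bold>\<rightarrow> \<^bold>V A \<^bold>\<rightarrow> \<^bold>V B)"
| "lpv_minus_axiom (t \<^bold>: A \<^bold>\<rightarrow> \<^bold>V A)"

inductive lpv_axiom :: "lpv_fm \<Rightarrow> bool" where
  "lpv_minus_axiom A \<Longrightarrow> lpv_axiom A"
| "lpv_axiom (\<^bold>\<not> (t \<^bold>: \<^bold>V \<^bold>\<bottom>))"

inductive an_derivable :: "(lpv_fm \<Rightarrow> bool) \<Rightarrow> lpv_fm \<Rightarrow> bool" for Ax where
  axiom: "Ax A \<Longrightarrow> an_derivable Ax A"
| mp: "an_derivable Ax (A \<^bold>\<rightarrow> B) \<Longrightarrow> an_derivable Ax A \<Longrightarrow> an_derivable Ax B"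
| axiom_necessitation: "Ax A \<Longrightarrow> an_derivable Ax (PConst c \<^bold>: A)"

abbreviation lpv_minus_theorem :: "lpv_fm \<Rightarrow> bool" (\<open>LPV\<^sup>- \<turnstile> _\<close> [50] 50) where
  "LPV\<^sup>- \<turnstile> A \<equiv> an_derivable lpv_minus_axiom A"

abbreviation lpv_theorem :: "lpv_fm \<Rightarrow> bool" (\<open>LPV \<turnstile> _\<close> [50] 50) where
  "LPV \<turnstile> A \<equiv> an_derivable lpv_axiom A"


section \<open>Normal realisations\<close>

text \<open>
  An occurrence is the path of argument indices (0 or 1) leading to it from the root of the
  formula. A realisation assigns a proof term to every position; only its values at occurrences
  of \<open>\<box>\<close> matter.
\<close>

type_synonym position = "nat list"
type_synonym realisation = "position \<Rightarrow> proof_term"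

fun realise :: "realisation \<Rightarrow> bim_fm \<Rightarrow> lpv_fm" where
  "realise r (BAtom p) = Atom p"
| "realise r \<bottom>\<^sub>B = \<^bold>\<bottom>"
| "realise r (A \<and>\<^sub>B B) = realise (\<lambda>p. r (0 # p)) A \<^bold>\<and> realise (\<lambda>p. r (1 # p)) B"
| "realise r (A \<or>\<^sub>B B) = realise (\<lambda>p. r (0 # p)) A \<^bold>\<or> realise (\<lambda>p. r (1 # p)) B"
| "realise r (A \<rightarrow>\<^sub>B B) = realise (\<lambda>p. r (0 # p)) A \<^bold>\<rightarrow> realise (\<lambda>p. r (1 # p)) B"
| "realise r (\<box> A) = r [] \<^bold>: realise (\<lambda>p. r (0 # p)) A"
| "realise r (\<^bold>V\<^sub>B A) = \<^bold>V (realise (\<lambda>p. r (0 # p)) A)"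

text \<open>
  \<open>pos_boxes A\<close> and \<open>neg_boxes A\<close> are the positive and the negative occurrences of
  \<open>\<box>\<close> in \<open>A\<close>.
\<close>

fun pos_boxes neg_boxes :: "bim_fm \<Rightarrow> position set" where
  "pos_boxes (BAtom p) = {}"
| "pos_boxes \<bottom>\<^sub>B = {}"
| "pos_boxes (A \<and>\<^sub>B B) = (#) 0 ` pos_boxes A \<union> (#) 1 ` pos_boxes B"
| "pos_boxes (A \<or>\<^sub>B B) = (#) 0 ` pos_boxes A \<union> (#) 1 ` pos_boxes B"
| "pos_boxes (A \<rightarrow>\<^sub>B B) = (#) 0 ` neg_boxes A \<union> (#) 1 ` pos_boxes B"
| "pos_boxes (\<box> A) = insert [] ((#) 0 ` pos_boxes A)"
| "pos_boxes (\<^bold>V\<^sub>B A) = (#) 0 ` pos_boxes A"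
| "neg_boxes (BAtom p) = {}"
| "neg_boxes \<bottom>\<^sub>B = {}"
| "neg_boxes (A \<and>\<^sub>B B) = (#) 0 ` neg_boxes A \<union> (#) 1 ` neg_boxes B"
| "neg_boxes (A \<or>\<^sub>B B) = (#) 0 ` neg_boxes A \<union> (#) 1 ` neg_boxes B"
| "neg_boxes (A \<rightarrow>\<^sub>B B) = (#) 0 ` pos_boxes A \<union> (#) 1 ` neg_boxes B"
| "neg_boxes (\<box> A) = (#) 0 ` neg_boxes A"
| "neg_boxes (\<^bold>V\<^sub>B A) = (#) 0 ` neg_boxes A"

definition normal_realisation :: "realisation \<Rightarrow> bim_fm \<Rightarrow> bool" where
  "normal_realisation r A \<longleftrightarrow> (\<forall>p \<in> neg_boxes A. \<exists>x. r p = PVar x)"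

end

theory Submission
  imports Defs "HOL-Library.Nat_Bijection"
begin

text \<open>
  The proof adapts Fitting's semantic proof of the realisation theorem, which needs no cut-free
  sequent calculus. Worlds are the maximal consistent theories of the logic of proofs, with
  \<open>\<Gamma> R \<Delta>\<close> iff \<open>t : A \<in> \<Gamma>\<close> implies \<open>A \<in> \<Delta>\<close>, and likewise for \<open>V\<close>; every translated theorem of
  epistemic logic holds in this frame. A quasi-realisation puts variables at the negative boxes,
  but \<open>t : (A\<^sub>1 \<or> \<dots> \<or> A\<^sub>n)\<close> at a positive box, with different quasi-realisations \<open>A\<^sub>i\<close> of the body.
  If no finite disjunction of quasi-realisations of \<open>A\<close> is provable, then all of them are false
  at some world, and \<open>A\<close> fails there. So some finite disjunction is provable, and its members
  can be merged into one normal realisation after a substitution \<open>x \<mapsto> u \<cdot> x\<close> with ground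
  terms \<open>u\<close>.
\<close>

section \<open>Substitution\<close>

fun subst_tm :: "(nat \<Rightarrow> proof_term) \<Rightarrow> proof_term \<Rightarrow> proof_term" where
  "subst_tm \<sigma> (PVar x) = \<sigma> x"
| "subst_tm \<sigma> (PConst c) = PConst c"
| "subst_tm \<sigma> (t \<cdot> s) = subst_tm \<sigma> t \<cdot> subst_tm \<sigma> s"
| "subst_tm \<sigma> (t \<^bold>+ s) = subst_tm \<sigma> t \<^bold>+ subst_tm \<sigma> s"
| "subst_tm \<sigma> (\<^bold>! t) = \<^bold>! (subst_tm \<sigma> t)"

fun subst_fm :: "(nat \<Rightarrow> proof_term) \<Rightarrow> lpv_fm \<Rightarrow> lpv_fm" where
  "subst_fm \<sigma> (Atom p) = Atom p"
| "subst_fm \<sigma> \<^bold>\<bottom> = \<^bold>\<bottom>"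
| "subst_fm \<sigma> (A \<^bold>\<and> B) = subst_fm \<sigma> A \<^bold>\<and> subst_fm \<sigma> B"
| "subst_fm \<sigma> (A \<^bold>\<or> B) = subst_fm \<sigma> A \<^bold>\<or> subst_fm \<sigma> B"
| "subst_fm \<sigma> (A \<^bold>\<rightarrow> B) = subst_fm \<sigma> A \<^bold>\<rightarrow> subst_fm \<sigma> B"
| "subst_fm \<sigma> (\<^bold>V A) = \<^bold>V (subst_fm \<sigma> A)"
| "subst_fm \<sigma> (t \<^bold>: A) = subst_tm \<sigma> t \<^bold>: subst_fm \<sigma> A"

fun ground :: "proof_term \<Rightarrow> bool" where
  "ground (PVar x) \<longleftrightarrow> False"
| "ground (PConst c) \<longleftrightarrow> True"
| "ground (t \<cdot> s) \<longleftrightarrow> ground t \<and> ground s"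
| "ground (t \<^bold>+ s) \<longleftrightarrow> ground t \<and> ground s"
| "ground (\<^bold>! t) \<longleftrightarrow> ground t"

lemma subst_tm_ground: "ground t \<Longrightarrow> subst_tm \<sigma> t = t"
  by (induction t) auto

lemma subst_tm_subst_tm: "subst_tm \<tau> (subst_tm \<sigma> t) = subst_tm (subst_tm \<tau> \<circ> \<sigma>) t"
  by (induction t) auto

lemma subst_fm_subst_fm: "subst_fm \<tau> (subst_fm \<sigma> A) = subst_fm (subst_tm \<tau> \<circ> \<sigma>) A"
  by (induction A) (auto simp: subst_tm_subst_tm comp_def)

text \<open>Formulas \<open>V A\<close> and \<open>t : A\<close> are propositional atoms, so a
  substitution can be absorbed into the valuation. Tautologies are therefore stable under
  substitution.\<close>

lemma truth_subst_fm: "truth v (subst_fm \<sigma> A) = truth (v \<circ> subst_fm \<sigma>) A"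
  by (induction A) auto

lemma tautology_subst_fm: "tautology A \<Longrightarrow> tautology (subst_fm \<sigma> A)"
  by (simp add: tautology_def truth_subst_fm)

lemma lpv_minus_axiom_subst_fm: "lpv_minus_axiom A \<Longrightarrow> lpv_minus_axiom (subst_fm \<sigma> A)"
  by (induction rule: lpv_minus_axiom.induct)
    (auto intro: lpv_minus_axiom.intros tautology_subst_fm)

lemma lpv_axiom_subst_fm: "lpv_axiom A \<Longrightarrow> lpv_axiom (subst_fm \<sigma> A)"
  by (induction rule: lpv_axiom.induct) (auto intro: lpv_axiom.intros lpv_minus_axiom_subst_fm)

lemma subst_fm_realise: "subst_fm \<sigma> (realise r A) = realise (subst_tm \<sigma> \<circ> r) A"
  by (induction A arbitrary: r) (auto simp: comp_def)

section \<open>Multiplying variables by ground terms\<close>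

text \<open>From \<open>u : (B \<rightarrow> A)\<close> follows
  \<open>x : B \<rightarrow> (u \<cdot> x) : A\<close>. Thus \<open>x\<close> may stay at a negative
  box whose body changes from \<open>A\<close> to \<open>B\<close>, if \<open>x\<close> becomes
  \<open>u \<cdot> x\<close> wherever it belonged to \<open>A\<close>. The map \<open>e\<close>
  records the multipliers.\<close>

definition shift :: "(nat \<rightharpoonup> proof_term) \<Rightarrow> nat \<Rightarrow> proof_term" where
  "shift e y = (case e y of None \<Rightarrow> PVar y | Some u \<Rightarrow> u \<cdot> PVar y)"

text \<open>The second substitution meets \<open>u \<cdot> y\<close> for \<open>y\<close> in
  \<open>dom e1\<close>: it fixes \<open>u\<close> because \<open>u\<close> is ground, and
  \<open>y\<close> because the domains are disjoint.\<close>

lemma shift_map_add: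
  assumes "dom e1 \<inter> dom e2 = {}" "\<forall>u\<in>ran e1. ground u"
  shows "subst_tm (shift e2) \<circ> shift e1 = shift (e1 ++ e2)"
proof
  fix y
  show "(subst_tm (shift e2) \<circ> shift e1) y = shift (e1 ++ e2) y"
  proof (cases "e1 y")
    case None
    then show ?thesis by (simp add: shift_def map_add_def split: option.split)
  next
    case (Some u)
    then have "e2 y = None" "ground u" using assms by (auto intro: ranI)
    then show ?thesis using Some by (simp add: shift_def map_add_def subst_tm_ground)
  qed
qed

section \<open>Finite disjunctions\<close>

fun disj :: "lpv_fm list \<Rightarrow> lpv_fm" where
  "disj [] = \<^bold>\<bottom>"
| "disj (A # As) = A \<^bold>\<or> disj As"

lemma truth_disj: "truth v (disj As) \<longleftrightarrow> (\<exists>A\<in>set As. truth v A)"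
  by (induction As) auto

lemma subst_fm_disj: "subst_fm \<sigma> (disj As) = disj (map (subst_fm \<sigma>) As)"
  by (induction As) auto


section \<open>Kripke semantics of the translation\<close>

text \<open>The worlds are an explicit set because the canonical worlds are only some of the sets of
  formulas.\<close>

fun sat :: "'w set \<Rightarrow> ('w \<Rightarrow> 'w \<Rightarrow> bool) \<Rightarrow> ('w \<Rightarrow> 'w \<Rightarrow> bool) \<Rightarrow> ('w \<Rightarrow> nat \<Rightarrow> bool)
    \<Rightarrow> 'w \<Rightarrow> bim_fm \<Rightarrow> bool" where
  "sat W R S val w (BAtom p) \<longleftrightarrow> val w p"
| "sat W R S val w \<bottom>\<^sub>B \<longleftrightarrow> False"
| "sat W R S val w (A \<and>\<^sub>B B) \<longleftrightarrow> sat W R S val w A \<and> sat W R S val w B"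
| "sat W R S val w (A \<or>\<^sub>B B) \<longleftrightarrow> sat W R S val w A \<or> sat W R S val w B"
| "sat W R S val w (A \<rightarrow>\<^sub>B B) \<longleftrightarrow> (sat W R S val w A \<longrightarrow> sat W R S val w B)"
| "sat W R S val w (\<box> A) \<longleftrightarrow> (\<forall>v\<in>W. R w v \<longrightarrow> sat W R S val v A)"
| "sat W R S val w (\<^bold>V\<^sub>B A) \<longleftrightarrow> (\<forall>v\<in>W. S w v \<longrightarrow> sat W R S val v A)"

locale verification_frame =
  fixes W :: "'w set" and R S :: "'w \<Rightarrow> 'w \<Rightarrow> bool" and val :: "'w \<Rightarrow> nat \<Rightarrow> bool"
  assumes R_refl: "w \<in> W \<Longrightarrow> R w w"
    and R_trans: "u \<in> W \<Longrightarrow> v \<in> W \<Longrightarrow> w \<in> W \<Longrightarrow> R u v \<Longrightarrow> R v w \<Longrightarrow> R u w"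
    and S_imp_R: "v \<in> W \<Longrightarrow> w \<in> W \<Longrightarrow> S v w \<Longrightarrow> R v w"
begin

abbreviation forces :: "'w \<Rightarrow> iel_fm \<Rightarrow> bool" where
  "forces w A \<equiv> sat W R S val w (tr A)"

text \<open>Every translated formula starts with a box, so transitivity of \<open>R\<close> yields
  persistence.\<close>

lemma forces_mono:
  assumes "forces w A" "R w v" "w \<in> W" "v \<in> W"
  shows "forces v A"
proof -
  obtain B where B: "tr A = \<box> B" by (cases A rule: tr.cases) auto
  have "\<forall>u\<in>W. R w u \<longrightarrow> sat W R S val u B" using assms(1) B by simp
  then have "\<forall>u\<in>W. R v u \<longrightarrow> sat W R S val u B" using assms(2-) R_trans by blast
  then show ?thesis using B by simp
qed

lemma forces_Bot: "w \<in> W \<Longrightarrow> \<not> forces w \<bottom>\<^sub>I"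
  using R_refl by auto

lemma forces_And:
  assumes "w \<in> W"
  shows "forces w (A \<and>\<^sub>I B) \<longleftrightarrow> forces w A \<and> forces w B"
proof -
  have "forces w (A \<and>\<^sub>I B) \<longleftrightarrow> (\<forall>v\<in>W. R w v \<longrightarrow> forces v A \<and> forces v B)" by simp
  then show ?thesis using assms R_refl forces_mono by meson
qed

lemma forces_Or:
  assumes "w \<in> W"
  shows "forces w (A \<or>\<^sub>I B) \<longleftrightarrow> forces w A \<or> forces w B"
proof -
  have "forces w (A \<or>\<^sub>I B) \<longleftrightarrow> (\<forall>v\<in>W. R w v \<longrightarrow> forces v A \<or> forces v B)" by simp
  then show ?thesis using assms R_refl forces_mono by meson
qed

text \<open>The translation of a negation leaves its falsum unboxed. Reflexivity makes boxed falsum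
  false at every world as well, so both equations of \<open>tr\<close> give the same clause.\<close>

lemma forces_Imp: "forces w (A \<rightarrow>\<^sub>I B) \<longleftrightarrow> (\<forall>v\<in>W. R w v \<longrightarrow> forces v A \<longrightarrow> forces v B)"
proof (cases "B = \<bottom>\<^sub>I")
  case True
  then show ?thesis using R_refl by auto
next
  case False
  then have "tr (A \<rightarrow>\<^sub>I B) = \<box> (tr A \<rightarrow>\<^sub>B tr B)" by (cases B) auto
  then show ?thesis by simp
qed

lemma forces_Know:
  "forces w (\<^bold>K A) \<longleftrightarrow> (\<forall>v\<in>W. R w v \<longrightarrow> (\<forall>u\<in>W. S v u \<longrightarrow> forces u A))"
  by simp

section \<open>Soundness of the epistemic logics\<close>

text \<open>By the clauses above, the propositional axioms hold as in intuitionistic Kripke models.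
  For \<open>A \<rightarrow> K A\<close>, a world reached by \<open>R\<close> and then
  \<open>S\<close> is \<open>R\<close>-accessible, so persistence applies.\<close>

lemma forces_iel_minus_axiom: "iel_minus_axiom A \<Longrightarrow> w \<in> W \<Longrightarrow> forces w A"
proof (induction arbitrary: w rule: iel_minus_axiom.induct)
  case (1 A B)
  show ?case unfolding forces_Imp by (meson 1 forces_mono)
next
  case (2 A B C)
  show ?case unfolding forces_Imp by (meson 2 R_refl R_trans)
next
  case (3 A B)
  then show ?case by (simp add: forces_Imp forces_And del: tr.simps)
next
  case (4 A B)
  then show ?case by (simp add: forces_Imp forces_And del: tr.simps)
next
  case (5 A B)
  show ?case unfolding forces_Imp by (meson 5 forces_And forces_mono)
next
  case (6 A B)
  then show ?case by (simp add: forces_Imp forces_Or del: tr.simps)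
next
  case (7 B A)
  then show ?case by (simp add: forces_Imp forces_Or del: tr.simps)
next
  case (8 A C B)
  show ?case unfolding forces_Imp using 8 forces_Or by (meson R_refl R_trans)
next
  case (9 A)
  then show ?case by (simp add: forces_Imp forces_Bot del: tr.simps)
next
  case (10 A B)
  show ?case unfolding forces_Imp forces_Know by (meson 10 R_refl R_trans S_imp_R)
next
  case (11 A)
  show ?case unfolding forces_Imp forces_Know by (meson 11 R_trans S_imp_R forces_mono)
qed

lemma forces_mp: "w \<in> W \<Longrightarrow> forces w (A \<rightarrow>\<^sub>I B) \<Longrightarrow> forces w A \<Longrightarrow> forces w B"
  unfolding forces_Imp using R_refl by blast

lemma forces_iel_minus: "IEL\<^sup>- \<turnstile> A \<Longrightarrow> w \<in> W \<Longrightarrow> forces w A"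
proof (induction rule: mp_derivable.induct)
  case (axiom A)
  then show ?case using forces_iel_minus_axiom by blast
next
  case (mp A B)
  then show ?case using forces_mp by blast
qed

text \<open>Suppose \<open>K B\<close> and the negation of \<open>B\<close> hold at
  \<open>v\<close>. Go from \<open>v\<close> by \<open>R\<close> and then \<open>S\<close> to some
  \<open>t\<close>: there \<open>B\<close> holds because of \<open>K B\<close>, yet \<open>t\<close>
  is an \<open>R\<close>-successor of \<open>v\<close>, where \<open>B\<close> must fail.\<close>

lemma forces_iel:
  assumes serial: "\<And>w. w \<in> W \<Longrightarrow> \<exists>v\<in>W. R w v \<and> (\<exists>u\<in>W. S v u)"
  shows "IEL \<turnstile> A \<Longrightarrow> w \<in> W \<Longrightarrow> forces w A"
proof (induction rule: mp_derivable.induct)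
  case (axiom A)
  from axiom(1) show ?case
  proof cases
    case 1
    then show ?thesis using axiom forces_iel_minus_axiom by blast
  next
    case (2 B)
    have "\<not> forces v (\<not>\<^sub>I B)" if v: "v \<in> W" "forces v (\<^bold>K B)" for v
    proof
      assume neg: "forces v (\<not>\<^sub>I B)"
      obtain u t where "u \<in> W" "R v u" "t \<in> W" "S u t" using serial[OF v(1)] by blast
      then show False
        using v neg R_trans S_imp_R forces_Bot unfolding forces_Imp forces_Know by meson
    qed
    moreover have "forces v (\<^bold>K B)" if "forces u (\<^bold>K B)" "R u v" "u \<in> W" "v \<in> W" for u v
      using that forces_mono by blast
    ultimately show ?thesis
      using axiom(2) unfolding 2 forces_Imp[of _ "\<^bold>K B"] forces_Imp[of _ "\<not>\<^sub>I B"] by meson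
  qed
next
  case (mp A B)
  then show ?case using forces_mp by blast
qed

end


section \<open>Theories and the canonical model\<close>

text \<open>Both logics of proofs are instances. Closure of the axioms under substitution matters
  because merging substitutes in theorems.\<close>

locale verification_logic =
  fixes Ax :: "lpv_fm \<Rightarrow> bool"
  assumes Ax_lpv_minus: "lpv_minus_axiom A \<Longrightarrow> Ax A"
    and Ax_subst: "Ax A \<Longrightarrow> Ax (subst_fm \<sigma> A)"
begin

abbreviation (input) thm_of :: "lpv_fm \<Rightarrow> bool" (\<open>\<turnstile> _\<close> [50] 50) where
  "\<turnstile> A \<equiv> an_derivable Ax A"

section \<open>Derivability and internalisation\<close>

lemma derivable_lpv_minus: "lpv_minus_axiom A \<Longrightarrow> \<turnstile> A"
  by (simp add: Ax_lpv_minus an_derivable.axiom)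

lemma derivable_taut: "(\<And>v. truth v A) \<Longrightarrow> \<turnstile> A"
  by (simp add: derivable_lpv_minus lpv_minus_axiom.intros tautology_def)

lemma derivable_subst: "\<turnstile> A \<Longrightarrow> \<turnstile> subst_fm \<sigma> A"
  by (induction rule: an_derivable.induct) (auto intro: an_derivable.intros Ax_subst)

lemma derivable_app: "\<turnstile> t \<^bold>: (A \<^bold>\<rightarrow> B) \<Longrightarrow> \<turnstile> s \<^bold>: A \<^bold>\<rightarrow> (t \<cdot> s) \<^bold>: B"
  by (meson an_derivable.mp derivable_lpv_minus lpv_minus_axiom.intros(2))

text \<open>The term copies the derivation: a constant for an axiom, application for modus ponens,
  the checker for a necessitated axiom. Any constant may prove any axiom, hence the fixed index
  0.\<close>

lemma internalisation: "\<turnstile> A \<Longrightarrow> \<exists>u. ground u \<and> \<turnstile> u \<^bold>: A"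
proof (induction rule: an_derivable.induct)
  case (axiom A)
  then have "\<turnstile> PConst 0 \<^bold>: A" by (rule an_derivable.axiom_necessitation)
  then show ?case by (meson ground.simps)
next
  case (mp A B)
  then obtain u v where "ground u" "\<turnstile> u \<^bold>: (A \<^bold>\<rightarrow> B)" "ground v" "\<turnstile> v \<^bold>: A" by blast
  then have "ground (u \<cdot> v)" "\<turnstile> (u \<cdot> v) \<^bold>: B"
    by (auto intro: an_derivable.mp derivable_app)
  then show ?case by blast
next
  case (axiom_necessitation A c)
  then have "\<turnstile> \<^bold>! (PConst c) \<^bold>: PConst c \<^bold>: A"
    by (meson an_derivable.axiom_necessitation an_derivable.mp derivable_lpv_minus
        lpv_minus_axiom.intros(4))
  then show ?case by (meson ground.simps)
qed

lemma internalisation_finite: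
  assumes "finite S" "\<forall>A\<in>S. \<turnstile> A"
  shows "\<exists>u. ground u \<and> (\<forall>A\<in>S. \<turnstile> u \<^bold>: A)"
  using assms
proof (induction rule: finite_induct)
  case empty
  then show ?case by (meson empty_iff ground.simps(2))
next
  case (insert A S)
  then obtain u v where "ground u" "\<turnstile> u \<^bold>: A" "ground v" "\<forall>A\<in>S. \<turnstile> v \<^bold>: A"
    using internalisation by blast
  then have "ground (u \<^bold>+ v) \<and> (\<forall>A\<in>insert A S. \<turnstile> (u \<^bold>+ v) \<^bold>: A)"
    using an_derivable.mp derivable_lpv_minus lpv_minus_axiom.intros(5,6)
    by (metis ground.simps(4) insert_iff)
  then show ?case by blast
qed

text \<open>The sum of all terms in \<open>T\<close> proves whatever one of them proves, and it is
  chosen before the formula \<open>A\<close>.\<close>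

lemma sum_term_finite:
  assumes "finite T"
  shows "\<exists>s. \<forall>t\<in>T. \<forall>A. \<turnstile> t \<^bold>: A \<^bold>\<rightarrow> s \<^bold>: A"
  using assms
proof (induction rule: finite_induct)
  case empty
  then show ?case by simp
next
  case (insert t T)
  then obtain s where s: "\<forall>t\<in>T. \<forall>A. \<turnstile> t \<^bold>: A \<^bold>\<rightarrow> s \<^bold>: A" by blast
  have "\<turnstile> t' \<^bold>: A \<^bold>\<rightarrow> (t \<^bold>+ s) \<^bold>: A" if "t' \<in> insert t T" for t' A
  proof (cases "t' = t")
    case True
    then show ?thesis by (simp add: derivable_lpv_minus lpv_minus_axiom.intros(6))
  next
    case False
    have "\<turnstile> (t' \<^bold>: A \<^bold>\<rightarrow> s \<^bold>: A) \<^bold>\<rightarrow> (s \<^bold>: A \<^bold>\<rightarrow> (t \<^bold>+ s) \<^bold>: A) \<^bold>\<rightarrow> t' \<^bold>: A \<^bold>\<rightarrow> (t \<^bold>+ s) \<^bold>: A"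
      by (rule derivable_taut) simp
    moreover have "\<turnstile> t' \<^bold>: A \<^bold>\<rightarrow> s \<^bold>: A" using False s that by simp
    moreover have "\<turnstile> s \<^bold>: A \<^bold>\<rightarrow> (t \<^bold>+ s) \<^bold>: A"
      by (simp add: derivable_lpv_minus lpv_minus_axiom.intros(5))
    ultimately show ?thesis by (meson an_derivable.mp)
  qed
  then show ?case by blast
qed

section \<open>Closed theories\<close>

text \<open>Modus ponens is the only closure rule; necessitation enters solely through the theorems,
  so members of a theory act as hypotheses.\<close>

definition closed :: "lpv_fm set \<Rightarrow> bool" where
  "closed T \<longleftrightarrow> (\<forall>A. \<turnstile> A \<longrightarrow> A \<in> T) \<and> (\<forall>A B. A \<^bold>\<rightarrow> B \<in> T \<longrightarrow> A \<in> T \<longrightarrow> B \<in> T)"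

lemma closed_derivable: "closed T \<Longrightarrow> \<turnstile> A \<Longrightarrow> A \<in> T"
  by (simp add: closed_def)

lemma closed_mp: "closed T \<Longrightarrow> A \<^bold>\<rightarrow> B \<in> T \<Longrightarrow> A \<in> T \<Longrightarrow> B \<in> T"
  by (auto simp: closed_def)

lemma closed_lpv_minus:
  "closed T \<Longrightarrow> lpv_minus_axiom (A \<^bold>\<rightarrow> B) \<Longrightarrow> A \<in> T \<Longrightarrow> B \<in> T"
  by (rule closed_mp) (simp_all add: closed_derivable derivable_lpv_minus)

lemmas closed_app = closed_mp[OF _ closed_lpv_minus[OF _ lpv_minus_axiom.intros(2)]]
lemmas closed_reflection = closed_lpv_minus[OF _ lpv_minus_axiom.intros(3)]
lemmas closed_check = closed_lpv_minus[OF _ lpv_minus_axiom.intros(4)]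
lemmas closed_Ver_mp = closed_mp[OF _ closed_lpv_minus[OF _ lpv_minus_axiom.intros(7)]]
lemmas closed_Ver = closed_lpv_minus[OF _ lpv_minus_axiom.intros(8)]

lemma closed_taut1:
  assumes "closed T" "A \<in> T" "\<And>v. truth v A \<Longrightarrow> truth v B"
  shows "B \<in> T"
proof -
  have "\<turnstile> A \<^bold>\<rightarrow> B" using assms(3) by (intro derivable_taut) simp
  then show ?thesis using assms closed_derivable closed_mp by blast
qed

lemma closed_taut2:
  assumes "closed T" "A \<in> T" "B \<in> T" "\<And>v. truth v A \<Longrightarrow> truth v B \<Longrightarrow> truth v C"
  shows "C \<in> T"
proof -
  have "\<turnstile> A \<^bold>\<rightarrow> B \<^bold>\<rightarrow> C" using assms(4) by (intro derivable_taut) simp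
  then show ?thesis using assms closed_derivable closed_mp by blast
qed

lemma closed_derivables: "closed {A. \<turnstile> A}"
  by (auto simp: closed_def intro: an_derivable.mp)

lemma derivable_taut2: "\<turnstile> A \<Longrightarrow> \<turnstile> B \<Longrightarrow> (\<And>v. truth v A \<Longrightarrow> truth v B \<Longrightarrow> truth v C) \<Longrightarrow> \<turnstile> C"
  using closed_taut2[OF closed_derivables] by blast

text \<open>Necessitation for \<open>V\<close> is derived: internalise the implication and apply
  \<open>t : A \<rightarrow> V A\<close>.\<close>

lemma derivable_Ver_mono:
  assumes "\<turnstile> A \<^bold>\<rightarrow> B"
  shows "\<turnstile> \<^bold>V A \<^bold>\<rightarrow> \<^bold>V B"
proof -
  have "\<turnstile> \<^bold>V (A \<^bold>\<rightarrow> B)"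
    using internalisation[OF assms] an_derivable.mp derivable_lpv_minus lpv_minus_axiom.intros(8)
    by blast
  then show ?thesis using an_derivable.mp derivable_lpv_minus lpv_minus_axiom.intros(7) by blast
qed

lemma derivable_disj_imp:
  "(\<And>A. A \<in> set As \<Longrightarrow> \<turnstile> A \<^bold>\<rightarrow> B) \<Longrightarrow> \<turnstile> disj As \<^bold>\<rightarrow> B"
proof (induction As)
  case Nil
  show ?case by (rule derivable_taut) simp
next
  case (Cons A As)
  then have "\<turnstile> A \<^bold>\<rightarrow> B" "\<turnstile> disj As \<^bold>\<rightarrow> B" by auto
  then show ?case by (rule derivable_taut2) auto
qed

section \<open>Maximal consistent theories\<close>

definition complete :: "lpv_fm set \<Rightarrow> bool" where
  "complete T \<longleftrightarrow> closed T \<and> \<^bold>\<bottom> \<notin> T \<and> (\<forall>A. A \<in> T \<or> \<^bold>\<not> A \<in> T)"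

text \<open>This set is the theory generated by \<open>T\<close> and \<open>B\<close>; with this
  description the deduction theorem is built in.\<close>

lemma closed_extend: "closed T \<Longrightarrow> closed {C. B \<^bold>\<rightarrow> C \<in> T}"
  unfolding closed_def[of "{C. B \<^bold>\<rightarrow> C \<in> T}"] mem_Collect_eq
proof (intro conjI allI impI)
  fix A assume "closed T" "\<turnstile> A"
  then show "B \<^bold>\<rightarrow> A \<in> T" using closed_taut1[OF _ closed_derivable] by simp
next
  fix A C assume "closed T" "B \<^bold>\<rightarrow> A \<^bold>\<rightarrow> C \<in> T" "B \<^bold>\<rightarrow> A \<in> T"
  then show "B \<^bold>\<rightarrow> C \<in> T" by (rule closed_taut2) auto
qed

lemma closed_Union_chain:
  assumes "C \<noteq> {}" "\<And>T U. T \<in> C \<Longrightarrow> U \<in> C \<Longrightarrow> T \<subseteq> U \<or> U \<subseteq> T" "\<And>T. T \<in> C \<Longrightarrow> closed T"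
  shows "closed (\<Union>C)"
  unfolding closed_def
proof (intro conjI allI impI)
  fix A assume "\<turnstile> A"
  then show "A \<in> \<Union>C" using assms(1,3) closed_derivable by blast
next
  fix A B assume "A \<^bold>\<rightarrow> B \<in> \<Union>C" "A \<in> \<Union>C"
  then obtain T where "T \<in> C" "A \<^bold>\<rightarrow> B \<in> T" "A \<in> T" using assms(2) by blast
  then show "B \<in> \<Union>C" using assms(3) closed_mp by blast
qed

text \<open>Lindenbaum's lemma with a set \<open>Q\<close> to be kept out. Zorn's lemma gives a
  maximal closed extension of \<open>T\<close> containing no finite disjunction over
  \<open>Q\<close>; avoiding disjunctions, not just single members, is what forces
  completeness.\<close>

lemma complete_extension:
  assumes T: "closed T" and avoid: "\<And>As. set As \<subseteq> Q \<Longrightarrow> disj As \<notin> T"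
  obtains M where "complete M" "T \<subseteq> M" "M \<inter> Q = {}"
proof -
  define avoids where "avoids U \<longleftrightarrow> (\<forall>As. set As \<subseteq> Q \<longrightarrow> disj As \<notin> U)" for U
  define \<U> where "\<U> = {U. closed U \<and> T \<subseteq> U \<and> avoids U}"
  have "T \<in> \<U>" using assms by (simp add: \<U>_def avoids_def)
  moreover have "\<Union>C \<in> \<U>" if "C \<noteq> {}" "subset.chain \<U> C" for C
  proof -
    have "closed (\<Union>C)"
      using that by (intro closed_Union_chain) (auto simp: \<U>_def subset_chain_def)
    then show ?thesis using that by (auto simp: \<U>_def avoids_def subset_chain_def)
  qed
  ultimately obtain M where M: "M \<in> \<U>" and max: "\<forall>U\<in>\<U>. M \<subseteq> U \<longrightarrow> U = M"
    using subset_Zorn_nonempty[of \<U>] by blast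
  have cl: "closed M" and av: "avoids M" and "T \<subseteq> M" using M by (auto simp: \<U>_def)
  \<comment> \<open>Adding \<open>B\<close> to \<open>M\<close> gives a strictly larger theory,
    which by maximality contains a disjunction over \<open>Q\<close>.\<close>
  have ex: "\<exists>As. set As \<subseteq> Q \<and> B \<^bold>\<rightarrow> disj As \<in> M" if "B \<notin> M" for B
  proof (rule ccontr)
    let ?U = "{C. B \<^bold>\<rightarrow> C \<in> M}"
    assume "\<not> ?thesis"
    then have "avoids ?U" by (auto simp: avoids_def)
    moreover have "M \<subseteq> ?U" by (auto intro: closed_taut1[OF cl])
    ultimately have "?U = M"
      using max cl \<open>T \<subseteq> M\<close> closed_extend by (auto simp: \<U>_def)
    moreover have "B \<in> ?U" using closed_derivable[OF cl derivable_taut] by simp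
    ultimately show False using that by blast
  qed
  \<comment> \<open>If both \<open>A\<close> and its negation were missing, excluded middle would
    put the joined disjunction into \<open>M\<close>.\<close>
  have "A \<in> M \<or> \<^bold>\<not> A \<in> M" for A
  proof (rule ccontr)
    assume "\<not> ?thesis"
    then obtain As Bs where "set As \<subseteq> Q" "A \<^bold>\<rightarrow> disj As \<in> M" "set Bs \<subseteq> Q" "\<^bold>\<not> A \<^bold>\<rightarrow> disj Bs \<in> M"
      using ex by meson
    moreover from this(2,4) have "disj (As @ Bs) \<in> M"
      by (rule closed_taut2[OF cl]) (auto simp: truth_disj)
    ultimately have "disj (As @ Bs) \<in> M" "set (As @ Bs) \<subseteq> Q" by auto
    then show False using av by (auto simp: avoids_def)
  qed
  \<comment> \<open>Falsum is the disjunction of the empty list.\<close>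
  moreover have "\<^bold>\<bottom> \<notin> M" using av by (auto simp: avoids_def dest: spec[of _ "[]"])
  ultimately have "complete M" using cl by (simp add: complete_def)
  moreover have "M \<inter> Q = {}"
  proof (rule ccontr)
    assume "M \<inter> Q \<noteq> {}"
    then obtain A where "A \<in> M" "set [A] \<subseteq> Q" by auto
    from this(1) have "disj [A] \<in> M" by (rule closed_taut1[OF cl]) simp
    then show False using av \<open>set [A] \<subseteq> Q\<close> unfolding avoids_def by blast
  qed
  ultimately show thesis using that \<open>T \<subseteq> M\<close> by blast
qed

lemma
  assumes "complete T"
  shows complete_closed: "closed T"
    and complete_Bot: "\<^bold>\<bottom> \<notin> T"
    and complete_And: "A \<^bold>\<and> B \<in> T \<longleftrightarrow> A \<in> T \<and> B \<in> T"
    and complete_Or: "A \<^bold>\<or> B \<in> T \<longleftrightarrow> A \<in> T \<or> B \<in> T"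
    and complete_Imp: "A \<^bold>\<rightarrow> B \<in> T \<longleftrightarrow> (A \<in> T \<longrightarrow> B \<in> T)"
proof -
  have cl: "closed T" and bot: "\<^bold>\<bottom> \<notin> T" and neg: "\<And>A. A \<notin> T \<Longrightarrow> \<^bold>\<not> A \<in> T"
    using assms unfolding complete_def by blast+
  show "closed T" "\<^bold>\<bottom> \<notin> T" by (fact cl bot)+
  have "A \<in> T" "B \<in> T" if "A \<^bold>\<and> B \<in> T"
    by (rule closed_taut1[OF cl that]; simp)+
  moreover have "A \<^bold>\<and> B \<in> T" if "A \<in> T" "B \<in> T"
    by (rule closed_taut2[OF cl that]) simp
  ultimately show "A \<^bold>\<and> B \<in> T \<longleftrightarrow> A \<in> T \<and> B \<in> T" by blast
  have "A \<^bold>\<or> B \<in> T" if "A \<in> T"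
    by (rule closed_taut1[OF cl that]) simp
  moreover have "A \<^bold>\<or> B \<in> T" if "B \<in> T"
    by (rule closed_taut1[OF cl that]) simp
  moreover have "B \<in> T" if "A \<^bold>\<or> B \<in> T" "A \<notin> T"
    by (rule closed_taut2[OF cl that(1) neg[OF that(2)]]) simp
  ultimately show "A \<^bold>\<or> B \<in> T \<longleftrightarrow> A \<in> T \<or> B \<in> T" by blast
  have "A \<^bold>\<rightarrow> B \<in> T" if "A \<notin> T"
    by (rule closed_taut1[OF cl neg[OF that]]) simp
  moreover have "A \<^bold>\<rightarrow> B \<in> T" if "B \<in> T"
    by (rule closed_taut1[OF cl that]) simp
  ultimately show "A \<^bold>\<rightarrow> B \<in> T \<longleftrightarrow> (A \<in> T \<longrightarrow> B \<in> T)" using closed_mp[OF cl] by blast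
qed

section \<open>The canonical frame\<close>

definition proved :: "lpv_fm set \<Rightarrow> lpv_fm set" where
  "proved T = {A. \<exists>t. t \<^bold>: A \<in> T}"

definition verified :: "lpv_fm set \<Rightarrow> lpv_fm set" where
  "verified T = {A. \<^bold>V A \<in> T}"

text \<open>Application gives closure under modus ponens, and internalisation supplies a term for
  each theorem.\<close>

lemma closed_proved:
  assumes "closed T"
  shows "closed (proved T)"
  unfolding closed_def
proof (intro conjI allI impI)
  fix A assume "\<turnstile> A"
  then obtain u where "\<turnstile> u \<^bold>: A" using internalisation by blast
  then show "A \<in> proved T" using closed_derivable[OF assms] unfolding proved_def by blast
next
  fix A B assume "A \<^bold>\<rightarrow> B \<in> proved T" "A \<in> proved T"
  then obtain t s where "t \<^bold>: (A \<^bold>\<rightarrow> B) \<in> T" "s \<^bold>: A \<in> T" by (auto simp: proved_def)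
  then have "(t \<cdot> s) \<^bold>: B \<in> T"
    by (rule closed_app[OF assms assms])
  then show "B \<in> proved T" by (auto simp: proved_def)
qed

lemma proved_subset_verified: "closed T \<Longrightarrow> proved T \<subseteq> verified T"
  by (auto simp: proved_def verified_def intro: closed_Ver)

lemma closed_verified:
  assumes "closed T"
  shows "closed (verified T)"
  unfolding closed_def
proof (intro conjI allI impI)
  fix A assume "\<turnstile> A"
  then show "A \<in> verified T"
    using closed_derivable[OF closed_proved[OF assms]] proved_subset_verified[OF assms] by blast
next
  fix A B assume "A \<^bold>\<rightarrow> B \<in> verified T" "A \<in> verified T"
  then show "B \<in> verified T"
    unfolding verified_def mem_Collect_eq by (rule closed_Ver_mp[OF assms assms])
qed

abbreviation worlds :: "lpv_fm set set" where
  "worlds \<equiv> {T. complete T}"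

abbreviation provable_at :: "lpv_fm set \<Rightarrow> lpv_fm set \<Rightarrow> bool" where
  "provable_at T U \<equiv> proved T \<subseteq> U"

abbreviation verified_at :: "lpv_fm set \<Rightarrow> lpv_fm set \<Rightarrow> bool" where
  "verified_at T U \<equiv> verified T \<subseteq> U"

abbreviation holds :: "lpv_fm set \<Rightarrow> bim_fm \<Rightarrow> bool" where
  "holds \<equiv> sat worlds provable_at verified_at (\<lambda>T p. Atom p \<in> T)"

text \<open>The three frame conditions come from the axioms \<open>t : A \<rightarrow> A\<close>,
  positive introspection by the checker, and \<open>t : A \<rightarrow> V A\<close>.\<close>

sublocale canonical: verification_frame worlds provable_at verified_at "\<lambda>T p. Atom p \<in> T"
proof
  fix T assume "T \<in> worlds"
  then have cl: "closed T" by (simp add: complete_closed)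
  show "proved T \<subseteq> T"
    by (auto simp: proved_def dest: closed_reflection[OF cl])
next
  fix T U X assume T: "T \<in> worlds" and sub: "proved T \<subseteq> U" "proved U \<subseteq> X"
  have cl: "closed T" using T by (simp add: complete_closed)
  show "proved T \<subseteq> X"
  proof
    fix A assume "A \<in> proved T"
    then obtain t where "t \<^bold>: A \<in> T" by (auto simp: proved_def)
    then have "\<^bold>! t \<^bold>: t \<^bold>: A \<in> T"
      by (rule closed_check[OF cl])
    then show "A \<in> X" using sub by (auto simp: proved_def)
  qed
next
  fix T U assume "T \<in> worlds" "verified T \<subseteq> U"
  then show "proved T \<subseteq> U" using proved_subset_verified[of T] complete_closed by auto
qed


section \<open>Quasi-realisations\<close>

text \<open>
  The flag is the polarity of the formula as an occurrence. In negative position all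
  quasi-realisations are assumed jointly, in positive position at least one of them is to hold;
  hence disjunctions occur only under positive modalities. The variable at a negative box is
  determined by its position.
\<close>

fun quasi :: "bool \<Rightarrow> (position \<Rightarrow> nat) \<Rightarrow> bim_fm \<Rightarrow> lpv_fm set" where
  "quasi pos x (BAtom p) = {Atom p}"
| "quasi pos x \<bottom>\<^sub>B = {\<^bold>\<bottom>}"
| "quasi pos x (A \<and>\<^sub>B B) =
    (\<lambda>(X, Y). X \<^bold>\<and> Y) ` (quasi pos (\<lambda>p. x (0 # p)) A \<times> quasi pos (\<lambda>p. x (1 # p)) B)"
| "quasi pos x (A \<or>\<^sub>B B) =
    (\<lambda>(X, Y). X \<^bold>\<or> Y) ` (quasi pos (\<lambda>p. x (0 # p)) A \<times> quasi pos (\<lambda>p. x (1 # p)) B)"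
| "quasi pos x (A \<rightarrow>\<^sub>B B) =
    (\<lambda>(X, Y). X \<^bold>\<rightarrow> Y) ` (quasi (\<not> pos) (\<lambda>p. x (0 # p)) A \<times> quasi pos (\<lambda>p. x (1 # p)) B)"
| "quasi pos x (\<box> A) =
    (if pos then (\<lambda>(t, Xs). t \<^bold>: disj Xs) ` (UNIV \<times> lists (quasi pos (\<lambda>p. x (0 # p)) A))
     else (\<lambda>X. PVar (x []) \<^bold>: X) ` quasi pos (\<lambda>p. x (0 # p)) A)"
| "quasi pos x (\<^bold>V\<^sub>B A) =
    (if pos then (\<lambda>Xs. \<^bold>V (disj Xs)) ` lists (quasi pos (\<lambda>p. x (0 # p)) A)
     else Ver ` quasi pos (\<lambda>p. x (0 # p)) A)"

text \<open>The connectives form products; nonemptiness allows one factor to vary while a member of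
  the other is fixed. A positive modality contributes at least the empty disjunction.\<close>

lemma quasi_nonempty: "quasi pos x A \<noteq> {}"
  by (induction A arbitrary: pos x) auto

text \<open>Both polarities are proved together because an implication reverses that of its
  antecedent. At a positive modality a refuting world comes from \<open>complete_extension\<close>;
  at a negative one the bodies lie in every accessible world.\<close>

lemma truth_lemma:
  assumes "complete T"
  shows "(quasi True x A \<inter> T = {} \<longrightarrow> \<not> holds T A) \<and> (quasi False x A \<subseteq> T \<longrightarrow> holds T A)"
  using assms
proof (induction A arbitrary: T x)
  case (BAtom p)
  then show ?case by simp
next
  case BBot
  then show ?case by (simp add: complete_Bot)
next
  case (BAnd A B)
  have "quasi True (\<lambda>p. x (0 # p)) A \<inter> T = {} \<or> quasi True (\<lambda>p. x (1 # p)) B \<inter> T = {}"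
    if "quasi True x (A \<and>\<^sub>B B) \<inter> T = {}"
  proof -
    have "\<forall>X\<in>quasi True (\<lambda>p. x (0 # p)) A. \<forall>Y\<in>quasi True (\<lambda>p. x (1 # p)) B. X \<^bold>\<and> Y \<notin> T"
      using that by auto
    then show ?thesis
      using quasi_nonempty[of True "\<lambda>p. x (0 # p)" A] quasi_nonempty[of True "\<lambda>p. x (1 # p)" B]
      unfolding complete_And[OF BAnd.prems] by blast
  qed
  moreover have "quasi False (\<lambda>p. x (0 # p)) A \<subseteq> T \<and> quasi False (\<lambda>p. x (1 # p)) B \<subseteq> T"
    if "quasi False x (A \<and>\<^sub>B B) \<subseteq> T"
  proof -
    have "\<forall>X\<in>quasi False (\<lambda>p. x (0 # p)) A. \<forall>Y\<in>quasi False (\<lambda>p. x (1 # p)) B. X \<^bold>\<and> Y \<in> T"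
      using that by auto
    then show ?thesis
      using quasi_nonempty[of False "\<lambda>p. x (0 # p)" A] quasi_nonempty[of False "\<lambda>p. x (1 # p)" B]
      unfolding complete_And[OF BAnd.prems] by blast
  qed
  ultimately show ?case using BAnd.IH[OF BAnd.prems] by (metis sat.simps(3))
next
  case (BOr A B)
  have "quasi True (\<lambda>p. x (0 # p)) A \<inter> T = {} \<and> quasi True (\<lambda>p. x (1 # p)) B \<inter> T = {}"
    if "quasi True x (A \<or>\<^sub>B B) \<inter> T = {}"
  proof -
    have "\<forall>X\<in>quasi True (\<lambda>p. x (0 # p)) A. \<forall>Y\<in>quasi True (\<lambda>p. x (1 # p)) B. X \<^bold>\<or> Y \<notin> T"
      using that by auto
    then show ?thesis
      using quasi_nonempty[of True "\<lambda>p. x (0 # p)" A] quasi_nonempty[of True "\<lambda>p. x (1 # p)" B]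
      unfolding complete_Or[OF BOr.prems] by blast
  qed
  moreover have "quasi False (\<lambda>p. x (0 # p)) A \<subseteq> T \<or> quasi False (\<lambda>p. x (1 # p)) B \<subseteq> T"
    if "quasi False x (A \<or>\<^sub>B B) \<subseteq> T"
  proof -
    have "\<forall>X\<in>quasi False (\<lambda>p. x (0 # p)) A. \<forall>Y\<in>quasi False (\<lambda>p. x (1 # p)) B. X \<^bold>\<or> Y \<in> T"
      using that by auto
    then show ?thesis
      using quasi_nonempty[of False "\<lambda>p. x (0 # p)" A] quasi_nonempty[of False "\<lambda>p. x (1 # p)" B]
      unfolding complete_Or[OF BOr.prems] by blast
  qed
  ultimately show ?case using BOr.IH[OF BOr.prems] by (metis sat.simps(4))
next
  case (BImp A B)
  \<comment> \<open>A missing \<open>X\<close> or a present \<open>Y\<close> would put some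
    \<open>X \<rightarrow> Y\<close> into \<open>T\<close>, with any partner for the other
    component.\<close>
  have "quasi False (\<lambda>p. x (0 # p)) A \<subseteq> T \<and> quasi True (\<lambda>p. x (1 # p)) B \<inter> T = {}"
    if "quasi True x (A \<rightarrow>\<^sub>B B) \<inter> T = {}"
  proof -
    have "\<forall>X\<in>quasi False (\<lambda>p. x (0 # p)) A. \<forall>Y\<in>quasi True (\<lambda>p. x (1 # p)) B. X \<^bold>\<rightarrow> Y \<notin> T"
      using that by auto
    then show ?thesis
      using quasi_nonempty[of False "\<lambda>p. x (0 # p)" A] quasi_nonempty[of True "\<lambda>p. x (1 # p)" B]
      unfolding complete_Imp[OF BImp.prems] by blast
  qed
  moreover have "quasi True (\<lambda>p. x (0 # p)) A \<inter> T = {} \<or> quasi False (\<lambda>p. x (1 # p)) B \<subseteq> T"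
    if "quasi False x (A \<rightarrow>\<^sub>B B) \<subseteq> T"
  proof -
    have "\<forall>X\<in>quasi True (\<lambda>p. x (0 # p)) A. \<forall>Y\<in>quasi False (\<lambda>p. x (1 # p)) B. X \<^bold>\<rightarrow> Y \<in> T"
      using that by auto
    then show ?thesis
      using quasi_nonempty[of True "\<lambda>p. x (0 # p)" A] quasi_nonempty[of False "\<lambda>p. x (1 # p)" B]
      unfolding complete_Imp[OF BImp.prems] by blast
  qed
  ultimately show ?case using BImp.IH[OF BImp.prems] by (metis sat.simps(5))
next
  case (BBox A)
  let ?x = "\<lambda>p. x (0 # p)"
  have cl: "closed (proved T)" using BBox.prems closed_proved complete_closed by blast
  have "\<not> holds T (\<box> A)" if "quasi True x (\<box> A) \<inter> T = {}"
  proof -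
    \<comment> \<open>If some term proved this disjunction in \<open>T\<close>, that very formula
      would be a quasi-realisation of the box lying in \<open>T\<close>.\<close>
    have "disj As \<notin> proved T" if "set As \<subseteq> quasi True ?x A" for As
      using that \<open>quasi True x (\<box> A) \<inter> T = {}\<close> by (auto simp: proved_def lists_eq_set image_def)
    then obtain M where "complete M" "proved T \<subseteq> M" "M \<inter> quasi True ?x A = {}"
      using complete_extension[OF cl] by metis
    then show ?thesis using BBox.IH by (auto simp: Int_commute)
  qed
  moreover have "holds T (\<box> A)" if "quasi False x (\<box> A) \<subseteq> T"
  proof -
    have "quasi False ?x A \<subseteq> proved T" using that by (auto simp: proved_def)
    then show ?thesis using BBox.IH[of _ ?x] by auto
  qed
  ultimately show ?case by blast
next
  case (BVer A)
  let ?x = "\<lambda>p. x (0 # p)"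
  have cl: "closed (verified T)" using BVer.prems closed_verified complete_closed by blast
  have "\<not> holds T (\<^bold>V\<^sub>B A)" if "quasi True x (\<^bold>V\<^sub>B A) \<inter> T = {}"
  proof -
    have "disj As \<notin> verified T" if "set As \<subseteq> quasi True ?x A" for As
      using that \<open>quasi True x (\<^bold>V\<^sub>B A) \<inter> T = {}\<close> by (auto simp: verified_def lists_eq_set image_def)
    then obtain M where "complete M" "verified T \<subseteq> M" "M \<inter> quasi True ?x A = {}"
      using complete_extension[OF cl] by metis
    then show ?thesis using BVer.IH by (auto simp: Int_commute)
  qed
  moreover have "holds T (\<^bold>V\<^sub>B A)" if "quasi False x (\<^bold>V\<^sub>B A) \<subseteq> T"
  proof -
    have "quasi False ?x A \<subseteq> verified T" using that by (auto simp: verified_def)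
    then show ?thesis using BVer.IH[of _ ?x] by auto
  qed
  ultimately show ?case by blast
qed

text \<open>Otherwise the set of theorems extends to a world omitting all quasi-realisations of
  \<open>A\<close>, where \<open>A\<close> fails by the truth lemma.\<close>

lemma quasi_realisable:
  assumes "\<And>T. complete T \<Longrightarrow> holds T A"
  shows "\<exists>As. set As \<subseteq> quasi True x A \<and> \<turnstile> disj As"
proof (rule ccontr)
  assume "\<not> ?thesis"
  then have "\<And>As. set As \<subseteq> quasi True x A \<Longrightarrow> disj As \<notin> {A. \<turnstile> A}" by blast
  then obtain M where "complete M" "M \<inter> quasi True x A = {}"
    using complete_extension[OF closed_derivables] by metis
  then show False using assms truth_lemma[of M x A] by (auto simp: Int_commute)
qed


section \<open>Merging quasi-realisations\<close>

text \<open>Positive quasi-realisations are alternatives and must imply the merged formula; negative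
  ones are joint assumptions and must follow from it.\<close>

definition directed :: "bool \<Rightarrow> lpv_fm \<Rightarrow> lpv_fm \<Rightarrow> lpv_fm" where
  "directed pos A B = (if pos then A \<^bold>\<rightarrow> B else B \<^bold>\<rightarrow> A)"

text \<open>Here \<open>pos\<close> is the polarity of \<open>A\<close> within the whole formula, so
  the boxes reserved for variables are the negative ones of \<open>A\<close> if it holds and the
  positive ones otherwise.\<close>

definition merges :: "bool \<Rightarrow> (position \<Rightarrow> nat) \<Rightarrow> bim_fm \<Rightarrow> lpv_fm set \<Rightarrow> (nat \<rightharpoonup> proof_term)
    \<Rightarrow> realisation \<Rightarrow> bool" where
  "merges pos x A S e r \<longleftrightarrow>
    (\<forall>u\<in>ran e. ground u) \<and>
    (\<forall>p\<in>(if pos then neg_boxes A else pos_boxes A). r p = PVar (x p)) \<and>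
    (\<forall>X\<in>S. \<turnstile> directed pos (subst_fm (shift e) X) (realise r A))"

text \<open>Substitution preserves the provable implications. Since \<open>e'\<close> avoids the
  range of \<open>x\<close>, the reserved variables stay in place.\<close>

lemma merges_map_add:
  assumes "merges pos x A S e r" "dom e \<inter> dom e' = {}" "dom e' \<inter> range x = {}"
    "\<forall>u\<in>ran e'. ground u"
  shows "merges pos x A S (e ++ e') (subst_tm (shift e') \<circ> r)"
proof -
  have e: "\<forall>u\<in>ran e. ground u" using assms(1) by (simp add: merges_def)
  have "\<forall>u\<in>ran (e ++ e'). ground u"
    using e assms(2,4) by (auto simp: ran_map_add)
  moreover have "subst_tm (shift e') (PVar (x p)) = PVar (x p)" for p
  proof -
    have "e' (x p) = None" using assms(3) by blast
    then show ?thesis by (simp add: shift_def)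
  qed
  moreover have "\<turnstile> directed pos (subst_fm (shift (e ++ e')) X) (realise (subst_tm (shift e') \<circ> r) A)"
    if "X \<in> S" for X
  proof -
    have "\<turnstile> subst_fm (shift e') (directed pos (subst_fm (shift e) X) (realise r A))"
      using assms(1) that by (auto simp: merges_def intro!: derivable_subst)
    then show ?thesis
      by (auto simp: directed_def subst_fm_subst_fm subst_fm_realise shift_map_add[OF assms(2) e]
          split: if_splits)
  qed
  ultimately show ?thesis using assms(1) by (simp add: merges_def)
qed

text \<open>Injectivity gives the two subformulas disjoint variables, so the substitution made for
  one leaves the reserved variables of the other alone.\<close>

lemma merges_combine:
  assumes "inj x"
    and A: "merges pos1 (\<lambda>p. x (0 # p)) A S1 e1 r1" "dom e1 \<subseteq> range (\<lambda>p. x (0 # p))"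
    and B: "merges pos2 (\<lambda>p. x (1 # p)) B S2 e2 r2" "dom e2 \<subseteq> range (\<lambda>p. x (1 # p))"
  shows "\<exists>e r. dom e \<subseteq> range x \<and> merges pos1 (\<lambda>p. x (0 # p)) A S1 e (\<lambda>p. r (0 # p)) \<and>
    merges pos2 (\<lambda>p. x (1 # p)) B S2 e (\<lambda>p. r (1 # p))"
proof -
  \<comment> \<open>The root is a binary connective, not a box, so its value is left
    \<open>undefined\<close>.\<close>
  let ?r = "case_list undefined (\<lambda>i p. if i = 0 then (subst_tm (shift e2) \<circ> r1) p
    else (subst_tm (shift e1) \<circ> r2) p)"
  have disj: "range (\<lambda>p. x (0 # p)) \<inter> range (\<lambda>p. x (1 # p)) = {}"
    using assms(1) by (auto dest: injD)
  then have dom: "dom e1 \<inter> dom e2 = {}" using A(2) B(2) by blast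
  have "merges pos1 (\<lambda>p. x (0 # p)) A S1 (e1 ++ e2) (subst_tm (shift e2) \<circ> r1)"
    by (rule merges_map_add[OF A(1) dom]) (use B disj in \<open>auto simp: merges_def\<close>)
  moreover have "merges pos2 (\<lambda>p. x (1 # p)) B S2 (e2 ++ e1) (subst_tm (shift e1) \<circ> r2)"
    by (rule merges_map_add[OF B(1)]) (use A disj dom in \<open>auto simp: merges_def\<close>)
  moreover have "e2 ++ e1 = e1 ++ e2" using dom by (rule map_add_comm[symmetric])
  moreover have "dom (e1 ++ e2) \<subseteq> range x" using A(2) B(2) by auto
  ultimately show ?thesis by (intro exI[of _ "e1 ++ e2"] exI[of _ ?r]) (simp add: comp_def)
qed

lemma finite_subset_image_Times:
  assumes "finite S" "S \<subseteq> f ` (P \<times> Q)"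
  obtains P' Q' where "finite P'" "P' \<subseteq> P" "finite Q'" "Q' \<subseteq> Q" "S \<subseteq> f ` (P' \<times> Q')"
proof -
  obtain C where "finite C" "C \<subseteq> P \<times> Q" "S = f ` C"
    using finite_subset_image[OF assms] by blast
  moreover from this have "C \<subseteq> fst ` C \<times> snd ` C" "fst ` C \<subseteq> P" "snd ` C \<subseteq> Q" by force+
  ultimately show thesis by (intro that[of "fst ` C" "snd ` C"]) (simp_all add: image_mono)
qed

text \<open>Induction at both polarities. Keeping \<open>dom e\<close> among the variables of
  \<open>A\<close> makes branches combinable; new multipliers arise only at boxes in negative
  position.\<close>

lemma merges_exists:
  assumes "finite S" "S \<subseteq> quasi pos x A" "inj x"
  shows "\<exists>e r. dom e \<subseteq> range x \<and> merges pos x A S e r"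
  using assms
proof (induction A arbitrary: S pos x)
  case (BAtom p)
  then have "merges pos x (BAtom p) S Map.empty r" for r
    by (auto simp: merges_def directed_def intro!: derivable_taut)
  then show ?case by (metis dom_empty empty_subsetI)
next
  case BBot
  then have "merges pos x \<bottom>\<^sub>B S Map.empty r" for r
    by (auto simp: merges_def directed_def intro!: derivable_taut)
  then show ?case by (metis dom_empty empty_subsetI)
next
  case (BAnd A B)
  let ?x0 = "\<lambda>p. x (0 # p)" and ?x1 = "\<lambda>p. x (1 # p)"
  have inj: "inj ?x0" "inj ?x1" using BAnd.prems(3) by (auto simp: inj_def)
  obtain S1 S2 where S: "finite S1" "S1 \<subseteq> quasi pos ?x0 A" "finite S2" "S2 \<subseteq> quasi pos ?x1 B"
    "S \<subseteq> (\<lambda>(X, Y). X \<^bold>\<and> Y) ` (S1 \<times> S2)"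
    by (rule finite_subset_image_Times[OF BAnd.prems(1) BAnd.prems(2)[unfolded quasi.simps]])
  obtain e r where e: "dom e \<subseteq> range x" "merges pos ?x0 A S1 e (\<lambda>p. r (0 # p))"
    "merges pos ?x1 B S2 e (\<lambda>p. r (1 # p))"
    using BAnd.IH(1)[OF S(1,2) inj(1)] BAnd.IH(2)[OF S(3,4) inj(2)]
      merges_combine[OF BAnd.prems(3)] by metis
  have "\<turnstile> directed pos (subst_fm (shift e) (X \<^bold>\<and> Y)) (realise r (A \<and>\<^sub>B B))"
    if "X \<in> S1" "Y \<in> S2" for X Y
  proof (rule derivable_taut2)
    show "\<turnstile> directed pos (subst_fm (shift e) X) (realise (\<lambda>p. r (0 # p)) A)"
      "\<turnstile> directed pos (subst_fm (shift e) Y) (realise (\<lambda>p. r (1 # p)) B)"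
      using e that by (auto simp: merges_def)
  qed (auto simp: directed_def split: if_splits)
  then have "merges pos x (A \<and>\<^sub>B B) S e r" using e S(5) by (auto simp: merges_def split: if_splits)
  then show ?case using e by blast
next
  case (BOr A B)
  let ?x0 = "\<lambda>p. x (0 # p)" and ?x1 = "\<lambda>p. x (1 # p)"
  have inj: "inj ?x0" "inj ?x1" using BOr.prems(3) by (auto simp: inj_def)
  obtain S1 S2 where S: "finite S1" "S1 \<subseteq> quasi pos ?x0 A" "finite S2" "S2 \<subseteq> quasi pos ?x1 B"
    "S \<subseteq> (\<lambda>(X, Y). X \<^bold>\<or> Y) ` (S1 \<times> S2)"
    by (rule finite_subset_image_Times[OF BOr.prems(1) BOr.prems(2)[unfolded quasi.simps]])
  obtain e r where e: "dom e \<subseteq> range x" "merges pos ?x0 A S1 e (\<lambda>p. r (0 # p))"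
    "merges pos ?x1 B S2 e (\<lambda>p. r (1 # p))"
    using BOr.IH(1)[OF S(1,2) inj(1)] BOr.IH(2)[OF S(3,4) inj(2)]
      merges_combine[OF BOr.prems(3)] by metis
  have "\<turnstile> directed pos (subst_fm (shift e) (X \<^bold>\<or> Y)) (realise r (A \<or>\<^sub>B B))"
    if "X \<in> S1" "Y \<in> S2" for X Y
  proof (rule derivable_taut2)
    show "\<turnstile> directed pos (subst_fm (shift e) X) (realise (\<lambda>p. r (0 # p)) A)"
      "\<turnstile> directed pos (subst_fm (shift e) Y) (realise (\<lambda>p. r (1 # p)) B)"
      using e that by (auto simp: merges_def)
  qed (auto simp: directed_def split: if_splits)
  then have "merges pos x (A \<or>\<^sub>B B) S e r" using e S(5) by (auto simp: merges_def split: if_splits)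
  then show ?case using e by blast
next
  case (BImp A B)
  let ?x0 = "\<lambda>p. x (0 # p)" and ?x1 = "\<lambda>p. x (1 # p)"
  have inj: "inj ?x0" "inj ?x1" using BImp.prems(3) by (auto simp: inj_def)
  obtain S1 S2 where S: "finite S1" "S1 \<subseteq> quasi (\<not> pos) ?x0 A" "finite S2" "S2 \<subseteq> quasi pos ?x1 B"
    "S \<subseteq> (\<lambda>(X, Y). X \<^bold>\<rightarrow> Y) ` (S1 \<times> S2)"
    by (rule finite_subset_image_Times[OF BImp.prems(1) BImp.prems(2)[unfolded quasi.simps]])
  obtain e r where e: "dom e \<subseteq> range x" "merges (\<not> pos) ?x0 A S1 e (\<lambda>p. r (0 # p))"
    "merges pos ?x1 B S2 e (\<lambda>p. r (1 # p))"
    using BImp.IH(1)[OF S(1,2) inj(1)] BImp.IH(2)[OF S(3,4) inj(2)]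
      merges_combine[OF BImp.prems(3)] by metis
  have "\<turnstile> directed pos (subst_fm (shift e) (X \<^bold>\<rightarrow> Y)) (realise r (A \<rightarrow>\<^sub>B B))"
    if "X \<in> S1" "Y \<in> S2" for X Y
  proof (rule derivable_taut2)
    show "\<turnstile> directed (\<not> pos) (subst_fm (shift e) X) (realise (\<lambda>p. r (0 # p)) A)"
      "\<turnstile> directed pos (subst_fm (shift e) Y) (realise (\<lambda>p. r (1 # p)) B)"
      using e that by (auto simp: merges_def)
  qed (auto simp: directed_def split: if_splits)
  then have "merges pos x (A \<rightarrow>\<^sub>B B) S e r" using e S(5) by (auto simp: merges_def split: if_splits)
  then show ?case using e by blast
next
  case (BBox A)
  let ?x = "\<lambda>p. x (0 # p)"
  have inj: "inj ?x" using BBox.prems(3) by (auto simp: inj_def)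
  show ?case
  proof (cases pos)
    case True
    have "S \<subseteq> (\<lambda>(t, Xs). t \<^bold>: disj Xs) ` (UNIV \<times> lists (quasi True ?x A))"
      using BBox.prems(2) True by simp
    then obtain P where P: "finite P" "P \<subseteq> UNIV \<times> lists (quasi True ?x A)"
      "S = (\<lambda>(t, Xs). t \<^bold>: disj Xs) ` P"
      using finite_subset_image[OF BBox.prems(1)] by meson
    have sub: "(\<Union>c\<in>P. set (snd c)) \<subseteq> quasi True ?x A"
      by (rule UN_least) (use P(2) in auto)
    have "finite (\<Union>c\<in>P. set (snd c))" using P(1) by simp
    from BBox.IH[OF this sub inj] obtain e r
      where e: "dom e \<subseteq> range ?x" "merges True ?x A (\<Union>c\<in>P. set (snd c)) e r"
      by blast
    let ?\<sigma> = "shift e"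
    have "\<turnstile> subst_fm ?\<sigma> (disj Xs) \<^bold>\<rightarrow> realise r A" if "(t, Xs) \<in> P" for t Xs
      unfolding subst_fm_disj
      by (rule derivable_disj_imp) (use e that in \<open>force simp: merges_def directed_def\<close>)
    then have "\<forall>Y\<in>(\<lambda>(t, Xs). subst_fm ?\<sigma> (disj Xs) \<^bold>\<rightarrow> realise r A) ` P. \<turnstile> Y" by auto
    \<comment> \<open>The merged body follows from each of the finitely many disjunctions; one
      ground \<open>u\<close> proves all these implications.\<close>
    from internalisation_finite[OF finite_imageI[OF P(1)] this]
    obtain u where "\<forall>Y\<in>(\<lambda>(t, Xs). subst_fm ?\<sigma> (disj Xs) \<^bold>\<rightarrow> realise r A) ` P. \<turnstile> u \<^bold>: Y"
      by blast
    then have u: "\<turnstile> u \<^bold>: (subst_fm ?\<sigma> (disj Xs) \<^bold>\<rightarrow> realise r A)" if "(t, Xs) \<in> P" for t Xs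
      using that by auto
    \<comment> \<open>Each \<open>t : disj Xs\<close> gives its own proof of the merged body, namely
      \<open>u\<close> applied to the substituted \<open>t\<close>. The sum \<open>s\<close> of
      these terms goes to the box.\<close>
    from sum_term_finite[OF finite_imageI[OF P(1)]]
    obtain s where "\<forall>t'\<in>(\<lambda>(t, Xs). u \<cdot> subst_tm ?\<sigma> t) ` P. \<forall>B. \<turnstile> t' \<^bold>: B \<^bold>\<rightarrow> s \<^bold>: B"
      by blast
    then have s: "\<turnstile> (u \<cdot> subst_tm ?\<sigma> t) \<^bold>: B \<^bold>\<rightarrow> s \<^bold>: B" if "(t, Xs) \<in> P" for t Xs B
      using that by auto
    let ?r = "case_list s (\<lambda>i. r)"
    have "\<turnstile> subst_fm ?\<sigma> (t \<^bold>: disj Xs) \<^bold>\<rightarrow> realise ?r (\<box> A)" if "(t, Xs) \<in> P" for t Xs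
      by (rule derivable_taut2[OF derivable_app[OF u[OF that]] s[OF that]]) auto
    then have "\<forall>X\<in>S. \<turnstile> directed pos (subst_fm ?\<sigma> X) (realise ?r (\<box> A))"
      using P(3) True by (auto simp: directed_def)
    then have "merges pos x (\<box> A) S e ?r"
      using e(2) True by (auto simp: merges_def)
    moreover have "dom e \<subseteq> range x" using e(1) by blast
    ultimately show ?thesis by blast
  next
    case False
    have "S \<subseteq> (\<lambda>X. PVar (x []) \<^bold>: X) ` quasi False ?x A"
      using BBox.prems(2) False by simp
    then obtain S' where S': "finite S'" "S' \<subseteq> quasi False ?x A" "S = (\<lambda>X. PVar (x []) \<^bold>: X) ` S'"
      using finite_subset_image[OF BBox.prems(1)] by meson
    from BBox.IH[OF S'(1,2) inj] obtain e r
      where e: "dom e \<subseteq> range ?x" "merges False ?x A S' e r" by blast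
    have "\<forall>Y\<in>(\<lambda>X. realise r A \<^bold>\<rightarrow> subst_fm (shift e) X) ` S'. \<turnstile> Y"
      using e by (auto simp: merges_def directed_def)
    \<comment> \<open>In negative position the implications run from the merged body to the
      quasi-realisations.\<close>
    then obtain u where u: "ground u"
      "\<And>X. X \<in> S' \<Longrightarrow> \<turnstile> u \<^bold>: (realise r A \<^bold>\<rightarrow> subst_fm (shift e) X)"
      using internalisation_finite[OF finite_imageI[OF S'(1)]] by fastforce
    \<comment> \<open>The box keeps the variable \<open>x []\<close>, and the quasi-realisations
      receive \<open>u \<cdot> x []\<close> in its place.\<close>
    let ?e' = "[x [] \<mapsto> u]"
    have x: "x [] \<notin> range ?x" using BBox.prems(3) by (auto dest: injD)
    then have dom: "dom e \<inter> dom ?e' = {}" using e(1) by auto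
    let ?r = "subst_tm (shift ?e') \<circ> r"
    \<comment> \<open>The terms of \<open>r\<close> may contain \<open>x []\<close>, so the merged
      body has to undergo the new substitution too.\<close>
    have m: "merges False ?x A S' (e ++ ?e') ?r"
      by (rule merges_map_add[OF e(2) dom]) (use x u(1) in auto)
    have "\<turnstile> u \<^bold>: (realise ?r A \<^bold>\<rightarrow> subst_fm (shift (e ++ ?e')) X)" if "X \<in> S'" for X
      using derivable_subst[OF u(2)[OF that], of "shift ?e'"] e(2)
      by (simp add: merges_def subst_tm_ground[OF u(1)] subst_fm_realise subst_fm_subst_fm
          shift_map_add[OF dom] del: map_add_upd)
    then have app: "\<turnstile> PVar (x []) \<^bold>: realise ?r A \<^bold>\<rightarrow>
        (u \<cdot> PVar (x [])) \<^bold>: subst_fm (shift (e ++ ?e')) X" if "X \<in> S'" for X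
      using that by (intro derivable_app)
    let ?r' = "case_list (PVar (x [])) (\<lambda>i. ?r)"
    have "shift (e ++ ?e') (x []) = u \<cdot> PVar (x [])" by (simp add: shift_def)
    then have "\<forall>X\<in>S. \<turnstile> directed False (subst_fm (shift (e ++ ?e')) X) (realise ?r' (\<box> A))"
      using app S'(3) unfolding directed_def comp_def by (simp del: map_add_upd)
    then have "merges False x (\<box> A) S (e ++ ?e') ?r'"
      using m unfolding merges_def by (simp del: map_add_upd)
    moreover have "dom (e ++ ?e') \<subseteq> range x" using e(1) by auto
    ultimately show ?thesis using False by metis
  qed
next
  \<comment> \<open>No term annotates \<open>V\<close>, so monotonicity of \<open>V\<close> carries
    the implications over and \<open>e\<close> stays as for the body.\<close>
  case (BVer A)
  let ?x = "\<lambda>p. x (0 # p)"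
  have inj: "inj ?x" using BVer.prems(3) by (auto simp: inj_def)
  show ?case
  proof (cases pos)
    case True
    have "S \<subseteq> (\<lambda>Xs. \<^bold>V (disj Xs)) ` lists (quasi True ?x A)"
      using BVer.prems(2) True by simp
    then obtain P where P: "finite P" "P \<subseteq> lists (quasi True ?x A)" "S = (\<lambda>Xs. \<^bold>V (disj Xs)) ` P"
      using finite_subset_image[OF BVer.prems(1)] by meson
    have sub: "(\<Union>Xs\<in>P. set Xs) \<subseteq> quasi True ?x A"
      by (rule UN_least) (use P(2) in auto)
    have "finite (\<Union>Xs\<in>P. set Xs)" using P(1) by simp
    from BVer.IH[OF this sub inj] obtain e r
      where e: "dom e \<subseteq> range ?x" "merges True ?x A (\<Union>Xs\<in>P. set Xs) e r"
      by blast
    let ?r = "case_list undefined (\<lambda>i. r)"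
    have "\<turnstile> subst_fm (shift e) (disj Xs) \<^bold>\<rightarrow> realise r A" if "Xs \<in> P" for Xs
      unfolding subst_fm_disj
      by (rule derivable_disj_imp) (use e that in \<open>auto simp: merges_def directed_def\<close>)
    then have "\<turnstile> \<^bold>V (subst_fm (shift e) (disj Xs)) \<^bold>\<rightarrow> \<^bold>V (realise r A)" if "Xs \<in> P" for Xs
      using that by (intro derivable_Ver_mono)
    then have "\<forall>X\<in>S. \<turnstile> directed True (subst_fm (shift e) X) (realise ?r (\<^bold>V\<^sub>B A))"
      using P(3) unfolding directed_def by simp
    then have "merges True x (\<^bold>V\<^sub>B A) S e ?r"
      using e(2) unfolding merges_def by simp
    moreover have "dom e \<subseteq> range x" using e(1) by blast
    ultimately show ?thesis using True by metis
  next
    case False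
    have "S \<subseteq> Ver ` quasi False ?x A"
      using BVer.prems(2) False by simp
    then obtain S' where S': "finite S'" "S' \<subseteq> quasi False ?x A" "S = Ver ` S'"
      using finite_subset_image[OF BVer.prems(1)] by meson
    from BVer.IH[OF S'(1,2) inj] obtain e r
      where e: "dom e \<subseteq> range ?x" "merges False ?x A S' e r" by blast
    let ?r = "case_list undefined (\<lambda>i. r)"
    have "\<turnstile> \<^bold>V (realise r A) \<^bold>\<rightarrow> \<^bold>V (subst_fm (shift e) X)" if "X \<in> S'" for X
      using that e(2) unfolding merges_def directed_def by (intro derivable_Ver_mono) simp
    then have "\<forall>X\<in>S. \<turnstile> directed False (subst_fm (shift e) X) (realise ?r (\<^bold>V\<^sub>B A))"
      using S'(3) unfolding directed_def by simp
    then have "merges False x (\<^bold>V\<^sub>B A) S e ?r"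
      using e(2) unfolding merges_def by simp
    moreover have "dom e \<subseteq> range x" using e(1) by blast
    ultimately show ?thesis using False by metis
  qed
qed

section \<open>Realisation for both logics\<close>

text \<open>With \<open>list_encode\<close> every position has its own variable. All disjuncts of a
  provable disjunction of quasi-realisations are merged; after the substitution the disjunction is
  still provable and implies the merged formula.\<close>

theorem realisation:
  assumes "\<And>T. complete T \<Longrightarrow> holds T A"
  shows "\<exists>r. normal_realisation r A \<and> \<turnstile> realise r A"
proof -
  obtain As where As: "set As \<subseteq> quasi True list_encode A" "\<turnstile> disj As"
    using quasi_realisable[OF assms] by blast
  have "inj list_encode" by (rule inj_list_encode)
  then obtain e r where m: "merges True list_encode A (set As) e r"
    using merges_exists[OF finite_set As(1)] by blast
  have "\<turnstile> subst_fm (shift e) (disj As) \<^bold>\<rightarrow> realise r A"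
    unfolding subst_fm_disj
    by (rule derivable_disj_imp) (use m in \<open>auto simp: merges_def directed_def\<close>)
  then have "\<turnstile> realise r A" using derivable_subst[OF As(2)] an_derivable.mp by blast
  moreover have "normal_realisation r A" using m by (auto simp: merges_def normal_realisation_def)
  ultimately show ?thesis by blast
qed

end

interpretation minus: verification_logic lpv_minus_axiom
  by unfold_locales (auto intro: lpv_minus_axiom_subst_fm)

interpretation full: verification_logic lpv_axiom
  by unfold_locales (auto intro: lpv_axiom_subst_fm lpv_axiom.intros)

text \<open>
  The axiom \<open>\<not> t : V \<bottom>\<close> does not make \<open>V\<close> serial, but only provides some accessible world at
  which \<open>V \<bottom>\<close> fails.
\<close>

lemma full_serial:
  assumes "full.complete T"
  shows "\<exists>U. full.complete U \<and> full.proved T \<subseteq> U \<and> (\<exists>M. full.complete M \<and> full.verified U \<subseteq> M)"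
proof -
  have cl: "full.closed T" using assms by (rule full.complete_closed)
  have "\<^bold>V \<^bold>\<bottom> \<notin> full.proved T"
    using full.closed_derivable[OF cl an_derivable.axiom[where Ax = lpv_axiom, OF lpv_axiom.intros(2)]]
      full.closed_mp[OF cl] full.complete_Bot[OF assms] by (auto simp: full.proved_def)
  \<comment> \<open>A disjunction of copies of one formula implies that formula.\<close>
  moreover have "disj As \<notin> full.proved T"
    if "\<^bold>V \<^bold>\<bottom> \<notin> full.proved T" "set As \<subseteq> {\<^bold>V \<^bold>\<bottom>}" for As
  proof
    assume d: "disj As \<in> full.proved T"
    have "\<^bold>V \<^bold>\<bottom> \<in> full.proved T"
      by (rule full.closed_taut1[OF full.closed_proved[OF cl] d])
        (use that(2) in \<open>auto simp: truth_disj\<close>)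
    then show False using that(1) by contradiction
  qed
  ultimately obtain U where U: "full.complete U" "full.proved T \<subseteq> U" "U \<inter> {\<^bold>V \<^bold>\<bottom>} = {}"
    using full.complete_extension[OF full.closed_proved[OF cl], of "{\<^bold>V \<^bold>\<bottom>}"] by metis
  \<comment> \<open>With nothing to avoid, the only disjunction is falsum, so consistency of
    \<open>verified U\<close> is exactly the absence of verified falsum from
    \<open>U\<close>.\<close>
  then have "disj As \<notin> full.verified U" if "set As \<subseteq> {}" for As
    using that by (auto simp: full.verified_def)
  then obtain M where "full.complete M" "full.verified U \<subseteq> M"
    using full.complete_extension[OF full.closed_verified[OF full.complete_closed[OF U(1)]]] by metis
  then show ?thesis using U by blast
qed

theorem theorem8:
  fixes F :: iel_fm
  shows "(IEL\<^sup>- \<turnstile> F \<longrightarrow>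
            (\<exists>r. normal_realisation r (tr F) \<and> LPV\<^sup>- \<turnstile> realise r (tr F)))
       \<and> (IEL \<turnstile> F \<longrightarrow>
            (\<exists>r. normal_realisation r (tr F) \<and> LPV \<turnstile> realise r (tr F)))"
proof (intro conjI impI)
  assume "IEL\<^sup>- \<turnstile> F"
  then show "\<exists>r. normal_realisation r (tr F) \<and> LPV\<^sup>- \<turnstile> realise r (tr F)"
    by (intro minus.realisation minus.canonical.forces_iel_minus) simp_all
next
  assume "IEL \<turnstile> F"
  then show "\<exists>r. normal_realisation r (tr F) \<and> LPV \<turnstile> realise r (tr F)"
    by (intro full.realisation full.canonical.forces_iel) (use full_serial in auto)
qed

end
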